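(* The lower spectral radius $\check{\varrho} \colon \mathcal{K}(\mathit{GL}_2(\mathbb{R})) \to \mathbb{R}_+$ is continuous at every $\mathsf{A} \in \mathcal{K}(\mathit{SL}_2(\mathbb{R}))$. In particular the restriction $\check{\varrho} \colon \mathcal{K}(\mathit{SL}_2(\mathbb{R})) \to \mathbb{R}_+$ is continuous.
   Context: $\mathcal{K}(\mathit{GL}_2(\mathbb{R}))$ and $\mathcal{K}(\mathit{SL}_2(\mathbb{R}))$ are the sets of all nonempty compact subsets of $\mathit{GL}_2(\mathbb{R})$ and $\mathit{SL}_2(\mathbb{R})$ respectively, equipped with the Hausdorff metric $d_H(\mathsf{A},\mathsf{B}) = \max\{\sup_{A\in\mathsf{A}}\inf_{B\in\mathsf{B}}\|A-B\|, \sup_{B\in\mathsf{B}}\inf_{A\in\mathsf{A}}\|A-B\|\}$, where $\|\cdot\|$ is the Euclidean operator norm. $\mathbb{R}_+=[0,\infty)$. For a nonempty compact set $\mathsf{A}$ of matrices, the lower spectral radius is $$\check{\varrho}(\mathsf{A}) := \lim_{n\to\infty} \inf\{\|A_n\cdots A_1\|^{1/n} : A_1,\dots,A_n \in \mathsf{A}\} = \inf_{n\ge 1} \inf\{\|A_n\cdots A_1\|^{1/n} : A_1,\dots,A_n \in \mathsf{A}\}.$$ *)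

theory Defs
  imports "HOL-Analysis.Analysis"
begin

section \<open>Matrices and the operator norm\<close>

abbreviation opnorm :: "real^'n^'n \<Rightarrow> real" where
  "opnorm A \<equiv> onorm ((*v) A)"

definition GL2 :: "(real^2^2) set" where
  "GL2 = {A. invertible A}"

definition SL2 :: "(real^2^2) set" where
  "SL2 = {A. det A = 1}"

lemma SL2_subset_GL2: "SL2 \<subseteq> GL2"
  by (auto simp: SL2_def GL2_def invertible_det_nz)

lemma bl_matrix [simp]: "bounded_linear ((*v) (A :: real^'n^'n))"
  by (simp add: matrix_vector_mul_bounded_linear)

lemma opnorm_nonneg [simp]: "0 \<le> opnorm A"
  by (simp add: onorm_pos_le)

lemma opnorm_triangle: "opnorm (A + B) \<le> opnorm A + opnorm B"
proof -
  have "(*v) (A + B) = (\<lambda>x. A *v x + B *v x)"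
    by (rule ext) (rule matrix_vector_mult_add_rdistrib)
  then show ?thesis
    using onorm_triangle[OF bl_matrix bl_matrix, of A B] by (simp only:)
qed

lemma opnorm_0: "opnorm (0 :: real^'n^'n) = 0"
proof -
  have "(*v) (0 :: real^'n^'n) = (\<lambda>x. 0)" by auto
  then show ?thesis by (simp only: onorm_zero)
qed

lemma opnorm_diff_triangle: "opnorm (A - C) \<le> opnorm (A - B) + opnorm (B - C)"
  using opnorm_triangle[of "A - B" "B - C"] by simp

lemma opnorm_minus_commute: "opnorm (A - B) = opnorm (B - A)"
proof -
  have "(*v) (A - B) = (\<lambda>x. - ((B - A) *v x))"
    by (rule ext) (simp add: matrix_vector_mult_diff_rdistrib)
  then show ?thesis
    using onorm_neg[of "(*v) (B - A)"] by (simp only:)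
qed

lemma opnorm_le_norm: "opnorm (A :: real^'n^'n) \<le> real CARD('n) * real CARD('n) * norm A"
proof (rule onorm_le_matrix_component)
  show "\<bar>A $ i $ j\<bar> \<le> norm A" for i j
    using component_le_norm_cart[of "A $ i" j] Finite_Cartesian_Product.norm_nth_le[of A i]
    by linarith
qed

lemma norm_le_opnorm: "norm (A :: real^'n^'n) \<le> real CARD('n) * real CARD('n) * opnorm A"
proof -
  have "norm A \<le> (\<Sum>i\<in>UNIV. norm (A $ i))"
    unfolding norm_vec_def by (rule L2_set_le_sum) auto
  also have "\<dots> \<le> (\<Sum>i\<in>UNIV. \<Sum>j\<in>UNIV. \<bar>A $ i $ j\<bar>)"
    by (intro sum_mono norm_le_l1_cart)
  also have "\<dots> \<le> (\<Sum>i\<in>(UNIV::'n set). \<Sum>j\<in>(UNIV::'n set). opnorm A)"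
    by (intro sum_mono matrix_component_le_onorm)
  finally show ?thesis by simp
qed

lemma opnorm_mult: "opnorm (A ** B) \<le> opnorm A * opnorm B"
  using onorm_compose[OF bl_matrix bl_matrix, of A B]
  by (simp add: o_def matrix_vector_mul_assoc)


section \<open>The hyperspace of nonempty compact sets\<close>

text \<open>
  Compactness is with respect to the library topology on matrices, which the operator norm also
  induces (\<open>opnorm_le_norm\<close>, \<open>norm_le_opnorm\<close>).
\<close>
definition compacts :: "(real^'n^'n) set \<Rightarrow> (real^'n^'n) set set" where
  "compacts S = {A. A \<subseteq> S \<and> A \<noteq> {} \<and> compact A}"

definition hausdorff_dist :: "(real^'n^'n) set \<Rightarrow> (real^'n^'n) set \<Rightarrow> real" where
  "hausdorff_dist A B =
     max (SUP a\<in>A. INF b\<in>B. opnorm (a - b)) (SUP b\<in>B. INF a\<in>A. opnorm (a - b))"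

text \<open>
  The library's \<^typ>\<open>'a metric\<close> requires a distance that is symmetric and nonnegative on the whole
  type, not only on the carrier; hence the value \<open>0\<close> off the carrier, where the suprema may be
  taken over unbounded or empty sets. It is a metric by \<open>Metric_space_hausdorff\<close> below.
\<close>
definition hausdorff_metric :: "(real^'n^'n) set \<Rightarrow> (real^'n^'n) set metric" where
  "hausdorff_metric S = metric (compacts S,
     \<lambda>A B. if A \<in> compacts S \<and> B \<in> compacts S then hausdorff_dist A B else 0)"

definition hausdorff_topology :: "(real^'n^'n) set \<Rightarrow> (real^'n^'n) set topology" where
  "hausdorff_topology S = mtopology_of (hausdorff_metric S)"

lemma hausdorff_dist_commute: "hausdorff_dist A B = hausdorff_dist B A"
  by (simp add: hausdorff_dist_def max.commute opnorm_minus_commute)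

lemma compacts_bound:
  fixes A :: "(real^'n^'n) set"
  assumes "A \<in> compacts S"
  obtains c where "\<And>a. a \<in> A \<Longrightarrow> opnorm a \<le> c"
proof -
  from assms obtain k where k: "\<And>a. a \<in> A \<Longrightarrow> norm a \<le> k"
    using compact_imp_bounded[of A] unfolding compacts_def bounded_iff by blast
  have "opnorm a \<le> real CARD('n) * real CARD('n) * k" if "a \<in> A" for a
  proof -
    have "opnorm a \<le> real CARD('n) * real CARD('n) * norm a" by (rule opnorm_le_norm)
    also have "\<dots> \<le> real CARD('n) * real CARD('n) * k"
      by (rule mult_left_mono[OF k[OF that]]) simp
    finally show ?thesis .
  qed
  with that show thesis by blast
qed

lemma bdd_below_opnorm: "bdd_below ((\<lambda>b. opnorm (f b)) ` B)"
  by (rule bdd_belowI2[of _ 0]) simp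

lemma point_dist_le: "b \<in> B \<Longrightarrow> (INF b\<in>B. opnorm (a - b)) \<le> opnorm (a - b)"
  by (rule cINF_lower[OF bdd_below_opnorm])

lemma point_dist_nonneg: "B \<noteq> {} \<Longrightarrow> 0 \<le> (INF b\<in>B. opnorm (a - b))"
  by (rule cINF_greatest) auto

lemma bdd_above_point_dist:
  assumes "A \<in> compacts S" "B \<in> compacts T"
  shows "bdd_above ((\<lambda>a. INF b\<in>B. opnorm (a - b)) ` A)"
proof -
  obtain c where c: "\<And>a. a \<in> A \<Longrightarrow> opnorm a \<le> c" using compacts_bound assms(1) by blast
  obtain b where b: "b \<in> B" using assms(2) unfolding compacts_def by blast
  show ?thesis
  proof (rule bdd_aboveI2)
    fix a assume a: "a \<in> A"
    have "(INF b\<in>B. opnorm (a - b)) \<le> opnorm (a - b)" by (rule point_dist_le[OF b])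
    also have "\<dots> \<le> opnorm (a - 0) + opnorm (0 - b)" by (rule opnorm_diff_triangle)
    also have "\<dots> \<le> c + opnorm (0 - b)" using c[OF a] by simp
    finally show "(INF b\<in>B. opnorm (a - b)) \<le> c + opnorm (0 - b)" .
  qed
qed

lemma point_dist_le_hausdorff:
  assumes "A \<in> compacts S" "B \<in> compacts T" "a \<in> A"
  shows "(INF b\<in>B. opnorm (a - b)) \<le> hausdorff_dist A B"
  unfolding hausdorff_dist_def
  using cSUP_upper[OF assms(3) bdd_above_point_dist[OF assms(1,2)]] by linarith

lemma hausdorff_dist_leI:
  assumes "A \<noteq> {}" "B \<noteq> {}"
    and "\<And>a. a \<in> A \<Longrightarrow> (INF b\<in>B. opnorm (a - b)) \<le> r"
    and "\<And>b. b \<in> B \<Longrightarrow> (INF a\<in>A. opnorm (b - a)) \<le> r"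
  shows "hausdorff_dist A B \<le> r"
  unfolding hausdorff_dist_def
  using assms by (auto intro!: cSUP_least max.boundedI simp: opnorm_minus_commute)

lemma hausdorff_dist_nonneg:
  assumes "A \<in> compacts S" "B \<in> compacts T"
  shows "0 \<le> hausdorff_dist A B"
proof -
  obtain a where "a \<in> A" using assms unfolding compacts_def by blast
  then show ?thesis
    using point_dist_le_hausdorff[OF assms] point_dist_nonneg[of B a] assms(2)
    by (fastforce simp: compacts_def)
qed

lemma hausdorff_dist_triangle:
  assumes "A \<in> compacts S" "B \<in> compacts T" "C \<in> compacts U"
  shows "hausdorff_dist A C \<le> hausdorff_dist A B + hausdorff_dist B C"
proof -
  have *: "(INF c\<in>C. opnorm (a - c)) \<le> hausdorff_dist A B + hausdorff_dist B C"
    if A: "A \<in> compacts S" and B: "B \<in> compacts T" and C: "C \<in> compacts U" and a: "a \<in> A"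
    for A B C S T U and a :: "real^'a^'a"
  proof -
    have ne: "B \<noteq> {}" "C \<noteq> {}" using B C by (auto simp: compacts_def)
    have "(INF c\<in>C. opnorm (a - c)) - hausdorff_dist B C \<le> (INF b\<in>B. opnorm (a - b))"
    proof (rule cINF_greatest[OF ne(1)])
      fix b assume b: "b \<in> B"
      have "(INF c\<in>C. opnorm (a - c)) - opnorm (a - b) \<le> (INF c\<in>C. opnorm (b - c))"
      proof (rule cINF_greatest[OF ne(2)])
        fix c assume "c \<in> C"
        then show "(INF c\<in>C. opnorm (a - c)) - opnorm (a - b) \<le> opnorm (b - c)"
          using point_dist_le[of c C a] opnorm_diff_triangle[of a c b] by linarith
      qed
      then show "(INF c\<in>C. opnorm (a - c)) - hausdorff_dist B C \<le> opnorm (a - b)"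
        using point_dist_le_hausdorff[OF B C b] by linarith
    qed
    then show ?thesis using point_dist_le_hausdorff[OF A B a] by linarith
  qed
  show ?thesis
  proof (rule hausdorff_dist_leI)
    show "A \<noteq> {}" "C \<noteq> {}" using assms by (auto simp: compacts_def)
    show "(INF c\<in>C. opnorm (a - c)) \<le> hausdorff_dist A B + hausdorff_dist B C" if "a \<in> A" for a
      using *[OF assms that] .
    show "(INF a\<in>A. opnorm (c - a)) \<le> hausdorff_dist A B + hausdorff_dist B C" if "c \<in> C" for c
      using *[OF assms(3,2,1) that] by (simp add: hausdorff_dist_commute add.commute)
  qed
qed

lemma hausdorff_dist_self:
  assumes "A \<in> compacts S"
  shows "hausdorff_dist A A = 0"
proof -
  have z: "(INF b\<in>A. opnorm (a - b)) \<le> 0" if "a \<in> A" for a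
    using point_dist_le[OF that, of a] by (simp add: opnorm_0)
  have "hausdorff_dist A A \<le> 0"
    using assms z by (intro hausdorff_dist_leI) (auto simp: compacts_def)
  then show ?thesis using hausdorff_dist_nonneg[OF assms assms] by linarith
qed

lemma hausdorff_dist_eq_0_subset:
  fixes A B :: "(real^'n^'n) set"
  assumes "A \<in> compacts S" "B \<in> compacts T" "hausdorff_dist A B = 0"
  shows "A \<subseteq> B"
proof
  fix a assume a: "a \<in> A"
  have ne: "B \<noteq> {}" and cl: "closed B"
    using assms(2) compact_imp_closed by (auto simp: compacts_def)
  let ?N = "real CARD('n) * real CARD('n)"
  have "\<exists>b\<in>B. dist b a < e" if "e > 0" for e
  proof -
    have N: "?N > 0" by simp
    have "0 < e / ?N" using that N by (rule divide_pos_pos)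
    then have "(INF b\<in>B. opnorm (a - b)) < e / ?N"
      using point_dist_le_hausdorff[OF assms(1,2) a] assms(3) by linarith
    then obtain b where b: "b \<in> B" "opnorm (a - b) < e / ?N"
      using cINF_less_iff[OF ne bdd_below_opnorm] by blast
    have "dist b a \<le> ?N * opnorm (a - b)"
      using norm_le_opnorm[of "a - b"] by (simp add: dist_norm norm_minus_commute)
    also have "\<dots> < e" using b(2) N by (simp add: field_simps)
    finally show ?thesis using b(1) by blast
  qed
  then have "a \<in> closure B" by (simp add: closure_approachable)
  then show "a \<in> B" using cl by simp
qed

lemma Metric_space_hausdorff:
  "Metric_space (compacts S)
     (\<lambda>A B. if A \<in> compacts S \<and> B \<in> compacts S then hausdorff_dist A B else 0)"
proof
  fix A B
  assume AB: "A \<in> compacts S" "B \<in> compacts S"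
  then show "((if A \<in> compacts S \<and> B \<in> compacts S then hausdorff_dist A B else 0) = 0) = (A = B)"
    using hausdorff_dist_eq_0_subset[OF AB] hausdorff_dist_eq_0_subset[OF AB(2,1)]
      hausdorff_dist_self hausdorff_dist_commute[of A B] by auto
next
  fix A B C
  assume "A \<in> compacts S" "B \<in> compacts S" "C \<in> compacts S"
  then show "(if A \<in> compacts S \<and> C \<in> compacts S then hausdorff_dist A C else 0)
      \<le> (if A \<in> compacts S \<and> B \<in> compacts S then hausdorff_dist A B else 0)
        + (if B \<in> compacts S \<and> C \<in> compacts S then hausdorff_dist B C else 0)"
    using hausdorff_dist_triangle[of A S B S C S] by simp
next
  fix A B
  show "0 \<le> (if A \<in> compacts S \<and> B \<in> compacts S then hausdorff_dist A B else 0)"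
    using hausdorff_dist_nonneg[of A S B S] by simp
  show "(if A \<in> compacts S \<and> B \<in> compacts S then hausdorff_dist A B else 0)
      = (if B \<in> compacts S \<and> A \<in> compacts S then hausdorff_dist B A else 0)"
    using hausdorff_dist_commute[of A B] by simp
qed

lemma mspace_hausdorff_metric [simp]: "mspace (hausdorff_metric S) = compacts S"
  unfolding hausdorff_metric_def by (rule Metric_space.mspace_metric[OF Metric_space_hausdorff])

lemma mdist_hausdorff_metric:
  "A \<in> compacts S \<Longrightarrow> B \<in> compacts S \<Longrightarrow> mdist (hausdorff_metric S) A B = hausdorff_dist A B"
  unfolding hausdorff_metric_def by (simp add: Metric_space.mdist_metric[OF Metric_space_hausdorff])

lemma topspace_hausdorff_topology [simp]: "topspace (hausdorff_topology S) = compacts S"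
  by (simp add: hausdorff_topology_def)


section \<open>The lower spectral radius\<close>

definition words :: "'a set \<Rightarrow> nat \<Rightarrow> 'a list set" where
  "words A n = {w. set w \<subseteq> A \<and> length w = n}"

definition matrix_prod :: "(real^'n^'n) list \<Rightarrow> real^'n^'n" where
  "matrix_prod w = foldr (**) w (mat 1)"

text \<open>
  The list \<open>w = [A\<^sub>n, \<dots>, A\<^sub>1]\<close> stands for the product \<open>A\<^sub>n \<cdots> A\<^sub>1\<close>. That the limit exists, and equals
  the infimum over \<open>n \<ge> 1\<close>, for nonempty compact \<open>A\<close> is proved in \<open>lower_spectral_radius_LIMSEQ\<close> and
  \<open>lower_spectral_radius_eq_INF\<close>.
\<close>
definition lower_spectral_radius :: "(real^'n^'n) set \<Rightarrow> real" where
  "lower_spectral_radius A = lim (\<lambda>n. INF w\<in>words A n. root n (opnorm (matrix_prod w)))"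

lemma matrix_prod_append: "matrix_prod (v @ w) = matrix_prod v ** matrix_prod w"
  unfolding matrix_prod_def by (induction v) (auto simp: matrix_mul_assoc)

lemma words_nonempty:
  assumes "A \<noteq> {}"
  shows "words A n \<noteq> {}"
proof -
  obtain a where "a \<in> A" using assms by blast
  then have "replicate n a \<in> words A n" by (auto simp: words_def)
  then show ?thesis by blast
qed

lemma bdd_below_root_opnorm: "bdd_below ((\<lambda>w. root n (opnorm (f w))) ` W)"
  by (rule bdd_belowI2[of _ 0]) (simp add: real_root_ge_zero)

lemma opnorm_mat_1: "opnorm (mat 1 :: real^'n^'n) \<le> 1"
proof -
  have "((*v) (mat 1 :: real^'n^'n)) = (\<lambda>x. x)" by auto
  then show ?thesis using onorm_id_le[where 'a = "real^'n"] by (simp only:)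
qed

lemma opnorm_prod_concat_replicate:
  fixes a :: "real^'n^'n"
  shows
  "opnorm (matrix_prod (concat (replicate q w) @ replicate r a))
     \<le> opnorm (matrix_prod w) ^ q * opnorm a ^ r"
proof -
  have 1: "opnorm (matrix_prod (replicate r a)) \<le> opnorm a ^ r"
  proof (induction r)
    case 0 show ?case using opnorm_mat_1[where 'n = 'n] by (simp add: matrix_prod_def del: matrix_vector_mul_lid)
  next
    case (Suc r)
    have "opnorm (matrix_prod (replicate (Suc r) a)) \<le> opnorm a * opnorm (matrix_prod (replicate r a))"
      by (simp add: matrix_prod_def opnorm_mult)
    also have "\<dots> \<le> opnorm a * opnorm a ^ r" by (rule mult_left_mono[OF Suc]) simp
    finally show ?case by simp
  qed
  show ?thesis
  proof (induction q)
    case 0 show ?case using 1 by simp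
  next
    case (Suc q)
    let ?w = "concat (replicate q w) @ replicate r a"
    have "opnorm (matrix_prod (w @ ?w)) \<le> opnorm (matrix_prod w) * opnorm (matrix_prod ?w)"
      by (simp only: matrix_prod_append[of w] opnorm_mult)
    also have "\<dots> \<le> opnorm (matrix_prod w) * (opnorm (matrix_prod w) ^ q * opnorm a ^ r)"
      by (rule mult_left_mono[OF Suc]) simp
    finally show ?case by (simp add: mult.assoc)
  qed
qed

lemma lower_spectral_radius_aux:
  fixes A :: "(real^'n^'n) set"
  assumes "A \<noteq> {}"
  defines "b \<equiv> \<lambda>n. INF w\<in>words A n. root n (opnorm (matrix_prod w))"
  shows "b \<longlonglongrightarrow> (INF n\<in>{1..}. b n)"
proof -
  define L where "L = (INF n\<in>{1..}. b n)"
  have b0: "0 \<le> b n" for n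
    unfolding b_def by (rule cINF_greatest[OF words_nonempty[OF assms(1)]]) (simp add: real_root_ge_zero)
  have bdd: "bdd_below (b ` {1..})" by (rule bdd_belowI2[of _ 0]) (rule b0)
  have Lle: "L \<le> b n" if "n \<ge> 1" for n
    unfolding L_def by (rule cINF_lower[OF bdd]) (use that in simp)
  have L0: "0 \<le> L" unfolding L_def by (rule cINF_greatest) (auto simp: b0)
  obtain a where a: "a \<in> A" using assms(1) by blast
  have upper: "eventually (\<lambda>n. b n < u) sequentially" if u: "L < u" for u
  proof -
    obtain c where c: "L < c" "c < u" using u dense by blast
    have cp: "0 < c" using L0 c by linarith
    obtain m where m: "m \<ge> 1" "b m < c"
      using c(1) cINF_less_iff[OF _ bdd, of c] unfolding L_def by auto
    obtain w where w: "w \<in> words A m" "root m (opnorm (matrix_prod w)) < c"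
      using m(2) cINF_less_iff[OF words_nonempty[OF assms(1)] bdd_below_root_opnorm[of m matrix_prod]]
      unfolding b_def by blast
    have wc: "opnorm (matrix_prod w) \<le> c ^ m"
    proof -
      have "opnorm (matrix_prod w) = root m (opnorm (matrix_prod w)) ^ m"
        using m(1) by simp
      also have "\<dots> \<le> c ^ m" using w(2) by (intro power_mono) (auto simp: real_root_ge_zero)
      finally show ?thesis .
    qed
    define M where "M = max 1 (opnorm a / c)"
    have M1: "1 \<le> M" "opnorm a \<le> c * M"
    proof -
      have "c * (opnorm a / c) \<le> c * M" unfolding M_def using cp by (intro mult_left_mono) auto
      then show "opnorm a \<le> c * M" using cp by simp
    qed (simp add: M_def)
    have est: "b n \<le> c * root n (M ^ m)" if n: "n \<ge> 1" for n
    proof -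
      define q r where "q = n div m" and "r = n mod m"
      have nqr: "n = m * q + r" "r < m" using m(1) unfolding q_def r_def by simp_all
      let ?w = "concat (replicate q w) @ replicate r a"
      have "length ?w = n" using w(1) nqr(1)
        by (simp add: words_def length_concat sum_list_replicate mult.commute)
      moreover have "set ?w \<subseteq> A" using w(1) a by (auto simp: words_def)
      ultimately have "?w \<in> words A n" by (simp add: words_def)
      then have "b n \<le> root n (opnorm (matrix_prod ?w))"
        unfolding b_def by (intro cINF_lower[OF bdd_below_root_opnorm])
      also have "\<dots> \<le> root n (c ^ n * M ^ m)"
      proof (rule real_root_le_mono)
        show "n > 0" using n by simp
        have "opnorm (matrix_prod ?w) \<le> opnorm (matrix_prod w) ^ q * opnorm a ^ r"
          by (rule opnorm_prod_concat_replicate)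
        also have "\<dots> \<le> (c ^ m) ^ q * (c * M) ^ r"
          using wc M1 cp by (intro mult_mono power_mono) auto
        also have "\<dots> = c ^ n * M ^ r"
          by (simp add: nqr(1) power_add power_mult power_mult_distrib)
        also have "\<dots> \<le> c ^ n * M ^ m"
          using cp M1 nqr(2) by (intro mult_left_mono power_increasing) auto
        finally show "opnorm (matrix_prod ?w) \<le> c ^ n * M ^ m" .
      qed
      also have "\<dots> = c * root n (M ^ m)"
        using n cp by (simp add: real_root_mult real_root_power_cancel)
      finally show ?thesis .
    qed
    have "(\<lambda>n. c * root n (M ^ m)) \<longlonglongrightarrow> c * 1"
      using M1 by (intro tendsto_mult tendsto_const LIMSEQ_root_const) (auto intro: zero_less_power)
    then have "eventually (\<lambda>n. c * root n (M ^ m) < u) sequentially"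
      using c(2) by (auto dest: order_tendstoD)
    then show ?thesis
      using eventually_ge_at_top[of 1] by eventually_elim (use est in fastforce)
  qed
  show ?thesis
    unfolding L_def[symmetric]
  proof (rule order_tendstoI)
    fix l assume "l < L"
    then show "eventually (\<lambda>n. l < b n) sequentially"
      using Lle by (intro eventually_sequentiallyI[of 1]) fastforce
  next
    fix u assume "L < u"
    then show "eventually (\<lambda>n. b n < u) sequentially" by (rule upper)
  qed
qed

lemma lower_spectral_radius_LIMSEQ:
  assumes "A \<noteq> {}"
  shows "(\<lambda>n. INF w\<in>words A n. root n (opnorm (matrix_prod w))) \<longlonglongrightarrow> lower_spectral_radius A"
  using lower_spectral_radius_aux[OF assms] unfolding lower_spectral_radius_def
  by (simp only: limI)

lemma lower_spectral_radius_eq_INF: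
  assumes "A \<noteq> {}"
  shows "lower_spectral_radius A =
           (INF n\<in>{1..}. INF w\<in>words A n. root n (opnorm (matrix_prod w)))"
  using lower_spectral_radius_aux[OF assms] unfolding lower_spectral_radius_def
  by (rule limI)

end

theory Submission
  imports Defs
begin

text \<open>
  Write \<open>\<rho>\<close> for the lower spectral radius of a nonempty compact \<open>A \<subseteq> SL\<^sub>2\<close>. Semicontinuity from above is
  general: \<open>\<rho>\<close> is an infimum of roots of norms of single products, and each product depends
  continuously on its letters (\<open>upper_stable\<close>). The content is semicontinuity from below.

  Norms in \<open>SL\<^sub>2\<close> are at least \<open>1\<close>, so \<open>\<rho> \<ge> 1\<close>. Lower bounds below \<open>1\<close> are robust because the norm
  of a 2 by 2 matrix dominates the square root of its determinant, which is multiplicative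
  (\<open>lower_stable_below_1\<close>). Let now \<open>\<rho> > 1\<close>. Every product of \<open>n\<close> letters of \<open>A\<close> then has norm at
  least \<open>\<rho>\<^sup>n\<close>, which makes \<open>A\<close> uniformly hyperbolic. In geometric terms, the direction that a word
  contracts most stays away from the direction onto which any other word expands, so that norms
  almost multiply. Everything rests on one inequality, \<open>opnorm_three_factors\<close>:
  \<open>\<parallel>CB\<parallel> \<parallel>BA\<parallel> \<le> \<parallel>B\<parallel> \<parallel>CBA\<parallel> + \<bar>det B\<bar> \<parallel>C\<parallel> \<parallel>A\<parallel>\<close>. It says that if \<open>\<parallel>B\<parallel>\<^sup>2\<close> is much larger than
  \<open>\<bar>det B\<bar>\<close>, then the fraction of norm that \<open>CBA\<close> retains is, up to a small error, at least the product of
  the fractions that \<open>CB\<close> and \<open>BA\<close> retain.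
  It is used twice.

  First, it gives \<open>\<parallel>UV\<parallel> \<ge> \<kappa> \<parallel>U\<parallel> \<parallel>V\<parallel>\<close> for products \<open>U\<close>, \<open>V\<close> of \<open>N\<close> letters
  (\<open>almost_multiplicative\<close>). If \<open>UV\<close> lost too much norm, then so would \<open>PQ\<close>, where \<open>P\<close> and \<open>Q\<close> are the
  parts of \<open>U\<close> and \<open>V\<close> next to the junction, each cut where its norm is at most a moderate \<open>K\<close> for the last time. Then \<open>PQ\<close>
  would have a norm far below \<open>K\<^sup>\<delta>\<close> for every fixed \<open>\<delta> > 0\<close>, although it has at least of the order
  of \<open>log K\<close> letters and hence, by growth, a norm of at least some fixed positive power of \<open>K\<close>.
  With \<open>N = t\<^sup>2\<close> and \<open>K = M\<^sup>t\<close>, where \<open>M\<close> bounds the letters, one gets \<open>\<kappa> = M\<^sup>-\<^sup>2\<^sup>t\<close>. This is tiny, but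
  its \<open>N\<close>-th root tends to \<open>1\<close>.

  Secondly, it propagates almost multiplicativity from pairs of blocks to arbitrarily long products,
  as soon as the blocks are large compared with \<open>1/\<kappa>\<close> (\<open>avalanche\<close>). The hypotheses of the
  avalanche principle concern blocks of one fixed length \<open>N\<close>, so they survive a small perturbation of
  \<open>A\<close>, even to matrices with determinants only near \<open>1\<close>. Hence the lower spectral radius of a nearby
  set is at least the \<open>N\<close>-th root of \<open>\<kappa> \<rho>\<^sup>N\<close> up to a constant factor, which is as close to \<open>\<rho>\<close> as
  desired if \<open>t\<close> is large (\<open>lower_stable_above_1\<close>).
\<close>

section \<open>Plane geometry\<close>

definition wedge :: "real^2 \<Rightarrow> real^2 \<Rightarrow> real" where
  "wedge x y = x$1 * y$2 - x$2 * y$1"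

lemma abs_wedge_le: "\<bar>wedge x y\<bar> \<le> norm x * norm y"
proof -
  have "(wedge x y)\<^sup>2 \<le> (norm x * norm y)\<^sup>2"
  proof -
    have "(norm x * norm y)\<^sup>2 = (wedge x y)\<^sup>2 + (x \<bullet> y)\<^sup>2"
      unfolding power_mult_distrib power2_norm_eq_inner
      by (simp add: wedge_def inner_vec_def sum_2 power2_eq_square algebra_simps)
    then show ?thesis by simp
  qed
  then show ?thesis by (metis abs_le_square_iff abs_mult abs_norm_cancel)
qed

lemma wedge_matrix: "wedge (B *v x) (B *v y) = det B * wedge x y"
  by (simp add: wedge_def det_2 matrix_vector_mult_def sum_2 algebra_simps)

lemma norm_mult_le_opnorm: "norm (A *v x) \<le> opnorm A * norm x"
  for A :: "real^'n^'n"
  by (rule onorm) simp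

text \<open>
  Decompose \<open>p\<close> along \<open>q\<close> and its rotation by a right angle: the first part is at most \<open>\<parallel>p\<parallel>\<close> long,
  and the second part has length \<open>\<bar>wedge q p\<bar> / \<parallel>q\<parallel>\<close>.
\<close>
lemma norm_matrix_wedge_exchange:
  "norm q * norm (C *v p) \<le> norm p * norm (C *v q) + \<bar>wedge q p\<bar> * opnorm C"
  for C :: "real^2^2"
proof (cases "q = 0")
  case False
  define J where "J = (vector [- q$2, q$1] :: real^2)"
  have J: "norm J = norm q"
    by (simp add: J_def norm_vec_def L2_set_def sum_2 add.commute)
  have "(q \<bullet> q) *\<^sub>R p = (p \<bullet> q) *\<^sub>R q + wedge q p *\<^sub>R J"
    by (simp add: J_def vec_eq_iff forall_2 wedge_def inner_vec_def sum_2 algebra_simps)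
  then have "(q \<bullet> q) *\<^sub>R (C *v p) = (p \<bullet> q) *\<^sub>R (C *v q) + wedge q p *\<^sub>R (C *v J)"
    by (metis matrix_vector_mult_scaleR matrix_vector_right_distrib)
  then have "norm ((q \<bullet> q) *\<^sub>R (C *v p)) \<le> norm ((p \<bullet> q) *\<^sub>R (C *v q)) + norm (wedge q p *\<^sub>R (C *v J))"
    by (metis norm_triangle_ineq)
  then have "norm q * (norm q * norm (C *v p)) \<le> \<bar>p \<bullet> q\<bar> * norm (C *v q) + \<bar>wedge q p\<bar> * norm (C *v J)"
    by (simp add: power2_norm_eq_inner[symmetric] power2_eq_square mult.assoc)
  also have "\<dots> \<le> (norm p * norm q) * norm (C *v q) + \<bar>wedge q p\<bar> * (opnorm C * norm q)"
    using norm_mult_le_opnorm[of C J] J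
    by (intro add_mono mult_mono Cauchy_Schwarz_ineq2) auto
  also have "\<dots> = norm q * (norm p * norm (C *v q) + \<bar>wedge q p\<bar> * opnorm C)"
    by (simp add: algebra_simps)
  finally show ?thesis using False by (simp add: mult_le_cancel_left)
qed simp

lemma opnorm_mult_le:
  fixes A :: "real^'n^'n"
  assumes "0 \<le> k" "0 \<le> r" and "\<And>x. k * norm (A *v x) \<le> r * norm x"
  shows "k * opnorm A \<le> r"
proof (cases "k = 0")
  case False
  then have "opnorm A \<le> r / k"
    using assms by (intro onorm_le) (simp add: field_simps)
  then show ?thesis using False assms(1) by (simp add: field_simps)
qed (use assms in simp)

text \<open>
  Apply the previous exchange to \<open>p = B w\<close> and \<open>q = B A x\<close> and take suprema over unit vectors \<open>w\<close> and
  \<open>x\<close>. The wedge of the two vectors carries the factor \<open>det B\<close>, so the error term is negligible when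
  \<open>B\<close> is nearly of rank one, that is, when \<open>\<bar>det B\<bar>\<close> is small compared with \<open>\<parallel>B\<parallel>\<^sup>2\<close>.
\<close>
lemma opnorm_three_factors:
  fixes A B C :: "real^2^2"
  shows "opnorm (C ** B) * opnorm (B ** A)
           \<le> opnorm B * opnorm (C ** B ** A) + \<bar>det B\<bar> * opnorm C * opnorm A"
    (is "_ \<le> ?r")
proof -
  have r0: "0 \<le> ?r" by (intro add_nonneg_nonneg mult_nonneg_nonneg) auto
  have *: "norm (B ** A *v x) * norm (C ** B *v w) \<le> ?r * norm w * norm x" for w x
  proof -
    define y where "y = A *v x"
    have "norm (B *v y) * norm (C *v (B *v w))
        \<le> norm (B *v w) * norm (C *v (B *v y)) + \<bar>wedge (B *v y) (B *v w)\<bar> * opnorm C"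
      by (rule norm_matrix_wedge_exchange)
    also have "\<dots> \<le> (opnorm B * norm w) * (opnorm (C ** B ** A) * norm x)
        + (\<bar>det B\<bar> * ((opnorm A * norm x) * norm w)) * opnorm C"
    proof (intro add_mono mult_mono norm_mult_le_opnorm)
      show "norm (C *v (B *v y)) \<le> opnorm (C ** B ** A) * norm x"
        using norm_mult_le_opnorm[of "C ** B ** A" x]
        by (simp add: y_def matrix_vector_mul_assoc matrix_mul_assoc)
      have "\<bar>wedge y w\<bar> \<le> norm y * norm w" by (rule abs_wedge_le)
      also have "\<dots> \<le> (opnorm A * norm x) * norm w"
        unfolding y_def by (intro mult_right_mono norm_mult_le_opnorm) simp
      finally show "\<bar>wedge (B *v y) (B *v w)\<bar> \<le> \<bar>det B\<bar> * (opnorm A * norm x * norm w)"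
        unfolding wedge_matrix abs_mult by (rule mult_left_mono) simp
    qed (auto intro!: mult_nonneg_nonneg)
    also have "\<dots> = ?r * norm w * norm x" by (simp add: algebra_simps)
    finally show ?thesis by (simp add: y_def matrix_vector_mul_assoc)
  qed
  have "norm (C ** B *v w) * opnorm (B ** A) \<le> ?r * norm w" for w
    using r0 *[of _ w] by (intro opnorm_mult_le mult_nonneg_nonneg) (auto simp: mult_ac)
  then have "opnorm (B ** A) * opnorm (C ** B) \<le> ?r"
    using r0 by (intro opnorm_mult_le) (auto simp: mult_ac)
  then show ?thesis by (simp add: mult.commute)
qed

lemma det_eq_wedge: "det A = wedge (A *v axis 1 1) (A *v axis 2 1)" for A :: "real^2^2"
  by (simp add: wedge_def det_2 matrix_vector_mult_basis column_def)

lemma wedge_diff: "wedge x y - wedge x' y' = wedge (x - x') y + wedge x' (y - y')"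
  by (simp add: wedge_def algebra_simps)

lemma abs_det_diff_le: "\<bar>det X - det Y\<bar> \<le> opnorm (X - Y) * (opnorm X + opnorm Y)"
  for X Y :: "real^2^2"
proof -
  have col: "norm (Z *v axis i 1) \<le> opnorm Z" for Z :: "real^2^2" and i
    using norm_mult_le_opnorm[of Z "axis i 1"] by simp
  let ?e = "axis 1 1 :: real^2" and ?f = "axis 2 1 :: real^2"
  have "det X - det Y = wedge ((X - Y) *v ?e) (X *v ?f) + wedge (Y *v ?e) ((X - Y) *v ?f)"
    by (simp only: det_eq_wedge wedge_diff matrix_vector_mult_diff_rdistrib)
  also have "\<bar>\<dots>\<bar> \<le> norm ((X - Y) *v ?e) * norm (X *v ?f) + norm (Y *v ?e) * norm ((X - Y) *v ?f)"
    using abs_wedge_le by (meson abs_triangle_ineq add_mono order_trans)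
  also have "\<dots> \<le> opnorm (X - Y) * opnorm X + opnorm Y * opnorm (X - Y)"
    by (intro add_mono mult_mono col) auto
  finally show ?thesis by (simp add: algebra_simps)
qed

lemma abs_det_le_opnorm_sq: "\<bar>det X\<bar> \<le> (opnorm X)\<^sup>2" for X :: "real^2^2"
  using abs_det_diff_le[of X 0] by (simp add: opnorm_0 power2_eq_square det_2)

lemma opnorm_SL2_ge_1: "det X = 1 \<Longrightarrow> 1 \<le> opnorm X" for X :: "real^2^2"
  using abs_det_le_opnorm_sq[of X] opnorm_nonneg[of X]
  by (metis abs_one one_power2 power2_le_imp_le)

section \<open>Products of matrices\<close>

lemma matrix_prod_Nil [simp]: "matrix_prod [] = mat 1"
  and matrix_prod_Cons [simp]: "matrix_prod (a # w) = a ** matrix_prod w"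
  by (simp_all add: matrix_prod_def)

lemma opnorm_mat_1_eq: "opnorm (mat 1 :: real^'n^'n) = 1"
proof -
  have "((*v) (mat 1 :: real^'n^'n)) = (\<lambda>x. x)" by auto
  then show ?thesis using onorm_id[where 'a = "real^'n"] by (simp only:)
qed

lemma opnorm_matrix_prod_le:
  fixes A :: "(real^'n^'n) set"
  assumes "w \<in> words A n" "\<And>a. a \<in> A \<Longrightarrow> opnorm a \<le> L" "0 \<le> L"
  shows "opnorm (matrix_prod w) \<le> L ^ n"
  using assms(1)
proof (induction w arbitrary: n)
  case Nil
  then show ?case by (simp add: words_def opnorm_mat_1_eq del: matrix_vector_mul_lid)
next
  case (Cons a w)
  then obtain m where m: "n = Suc m" "w \<in> words A m" "a \<in> A" by (auto simp: words_def)
  have "opnorm (matrix_prod (a # w)) \<le> opnorm a * opnorm (matrix_prod w)"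
    by (simp add: opnorm_mult)
  also have "\<dots> \<le> L * L ^ m"
    using assms(2,3) m Cons.IH by (intro mult_mono) auto
  finally show ?case using m by simp
qed

lemma det_matrix_prod_eq_1:
  fixes A :: "(real^'n^'n) set"
  assumes "w \<in> words A n" "\<And>a. a \<in> A \<Longrightarrow> det a = 1"
  shows "det (matrix_prod w) = 1"
  using assms(1)
  by (induction w arbitrary: n) (auto simp: words_def det_mul assms(2))

lemma abs_det_matrix_prod_ge:
  fixes A :: "(real^'n^'n) set"
  assumes "w \<in> words A n" "\<And>a. a \<in> A \<Longrightarrow> s \<le> \<bar>det a\<bar>" "0 \<le> s"
  shows "s ^ n \<le> \<bar>det (matrix_prod w)\<bar>"
  using assms(1)
proof (induction w arbitrary: n)
  case (Cons a w)
  then obtain m where "n = Suc m" "w \<in> words A m" "a \<in> A" by (auto simp: words_def)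
  then show ?case
    using Cons.IH[of m] assms(2,3) by (auto simp: det_mul abs_mult intro!: mult_mono)
qed (simp add: words_def)

text \<open>
  Replacing one letter at a time costs at most \<open>e\<close> times the norms of the other letters.
\<close>
lemma matrix_prod_perturb:
  fixes X Y :: "(real^'n^'n) set"
  assumes near: "\<And>x. x \<in> X \<Longrightarrow> \<exists>y\<in>Y. opnorm (x - y) \<le> e"
    and X: "\<And>x. x \<in> X \<Longrightarrow> opnorm x \<le> L" and Y: "\<And>y. y \<in> Y \<Longrightarrow> opnorm y \<le> L"
    and L: "1 \<le> L" and e: "0 \<le> e" and w: "w \<in> words X n"
  shows "\<exists>u\<in>words Y n. opnorm (matrix_prod w - matrix_prod u) \<le> n * e * L ^ n"
  using w
proof (induction w arbitrary: n)
  case Nil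
  then show ?case by (auto simp: words_def onorm_zero intro!: bexI[of _ "[]"])
next
  case (Cons x w)
  then obtain m where m: "n = Suc m" "w \<in> words X m" "x \<in> X" by (auto simp: words_def)
  obtain u where u: "u \<in> words Y m" "opnorm (matrix_prod w - matrix_prod u) \<le> m * e * L ^ m"
    using Cons.IH m by blast
  obtain y where y: "y \<in> Y" "opnorm (x - y) \<le> e" using near m by blast
  let ?P = "matrix_prod w" and ?Q = "matrix_prod u"
  have "x ** ?P - y ** ?Q = x ** (?P - ?Q) + (x - y) ** ?Q"
    by (vector matrix_matrix_mult_def sum_subtractf[symmetric] sum.distrib[symmetric] algebra_simps)
  then have "opnorm (x ** ?P - y ** ?Q) \<le> opnorm (x ** (?P - ?Q)) + opnorm ((x - y) ** ?Q)"
    using opnorm_triangle by metis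
  also have "\<dots> \<le> opnorm x * opnorm (?P - ?Q) + opnorm (x - y) * opnorm ?Q"
    by (intro add_mono opnorm_mult)
  also have "\<dots> \<le> L * (m * e * L ^ m) + e * L ^ m"
    using u y m L e by (intro add_mono mult_mono X opnorm_matrix_prod_le[OF u(1) Y]) auto
  also have "e * L ^ m \<le> e * L ^ n"
    using L e m by (intro mult_left_mono power_increasing) auto
  finally have "opnorm (x ** ?P - y ** ?Q) \<le> n * e * L ^ n"
    using m by (simp add: algebra_simps)
  moreover have "y # u \<in> words Y n" using u y m by (auto simp: words_def)
  ultimately show ?case by (intro bexI[of _ "y # u"]) auto
qed

lemma matrix_prod_blocks:
  fixes B :: "(real^'n^'n) set"
  assumes "w \<in> words B (k * N)"
  shows "\<exists>bs\<in>words (matrix_prod ` words B N) k. matrix_prod w = matrix_prod bs"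
  using assms
proof (induction k arbitrary: w)
  case 0
  then show ?case by (auto simp: words_def)
next
  case (Suc k)
  then have t: "take N w \<in> words B N" and d: "drop N w \<in> words B (k * N)"
    by (auto simp: words_def dest: in_set_takeD in_set_dropD)
  obtain bs where bs: "bs \<in> words (matrix_prod ` words B N) k"
      "matrix_prod (drop N w) = matrix_prod bs" using Suc.IH[OF d] by blast
  have "matrix_prod w = matrix_prod (take N w) ** matrix_prod bs"
    by (metis append_take_drop_id bs(2) matrix_prod_append)
  then show ?case using bs(1) t
    by (intro bexI[of _ "matrix_prod (take N w) # bs"]) (auto simp: words_def)
qed

section \<open>Avalanche principle\<close>

text \<open>
  Induction along the list. With \<open>Y\<close> the first factor of the product and \<open>R\<close> the rest,
  \<open>opnorm_three_factors\<close> for \<open>X\<close>, \<open>Y\<close>, \<open>R\<close> gives the full constant \<open>c\<close> from the pair \<open>X\<close>, \<open>Y\<close>, minus an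
  error proportional to \<open>\<parallel>R\<parallel>\<close>. The induction hypothesis bounds \<open>\<parallel>R\<parallel>\<close> by \<open>\<parallel>Y R\<parallel>\<close>, and the bound on
  the determinant keeps the error below half of the gain. So the constant \<open>c/2\<close> does not
  deteriorate with the length.
\<close>
lemma avalanche_step:
  fixes S :: "(real^2^2) set"
  assumes mult: "\<And>X Y. X \<in> S \<Longrightarrow> Y \<in> S \<Longrightarrow> c * opnorm X * opnorm Y \<le> opnorm (X ** Y)"
    and det: "\<And>X. X \<in> S \<Longrightarrow> 4 * \<bar>det X\<bar> \<le> c\<^sup>2 * (opnorm X)\<^sup>2"
    and pos: "\<And>X. X \<in> S \<Longrightarrow> 0 < opnorm X"
    and c: "0 < c" "c \<le> 1"
    and "X \<in> S" "set bs \<subseteq> S"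
  shows "c / 2 * opnorm X * opnorm (matrix_prod bs) \<le> opnorm (X ** matrix_prod bs)"
  using assms(6,7)
proof (induction bs arbitrary: X)
  case Nil
  have "c * opnorm X \<le> 2 * opnorm X"
    using c by (intro mult_right_mono) auto
  then show ?case by (simp add: opnorm_mat_1_eq del: matrix_vector_mul_lid)
next
  case (Cons Y bs)
  define R where "R = matrix_prod bs"
  have S: "X \<in> S" "Y \<in> S" "set bs \<subseteq> S" using Cons.prems by auto
  define x y z where "x = opnorm X" and "y = opnorm Y" and "z = opnorm (Y ** R)"
  have nn: "0 \<le> x" "0 < y" "0 \<le> z" "0 \<le> opnorm R"
    using S pos by (simp_all add: x_def y_def z_def)
  have IH: "c / 2 * y * opnorm R \<le> z"
    using Cons.IH[OF S(2,3)] by (simp add: R_def y_def z_def)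
  have "(c * x * y) * z \<le> opnorm (X ** Y) * z"
    using mult[OF S(1,2)] nn by (intro mult_right_mono) (auto simp: x_def y_def)
  also have "\<dots> \<le> y * opnorm (X ** Y ** R) + \<bar>det Y\<bar> * x * opnorm R"
    using opnorm_three_factors[of X Y R] by (simp add: x_def y_def z_def)
  also have "\<bar>det Y\<bar> * x * opnorm R \<le> (c\<^sup>2 * y\<^sup>2 / 4) * x * opnorm R"
    using det[OF S(2)] nn by (intro mult_right_mono) (auto simp: y_def)
  also have "\<dots> = (c * x * y / 2) * (c / 2 * y * opnorm R)"
    by (simp add: power2_eq_square)
  also have "\<dots> \<le> (c * x * y / 2) * z"
    using IH nn c by (intro mult_left_mono) auto
  finally have "y * (c / 2 * x * z) \<le> y * opnorm (X ** Y ** R)"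
    by (simp add: algebra_simps)
  then have "c / 2 * x * z \<le> opnorm (X ** Y ** R)" using nn by simp
  then show ?case by (simp add: x_def z_def R_def matrix_mul_assoc)
qed

lemma avalanche:
  fixes S :: "(real^2^2) set"
  assumes mult: "\<And>X Y. X \<in> S \<Longrightarrow> Y \<in> S \<Longrightarrow> c * opnorm X * opnorm Y \<le> opnorm (X ** Y)"
    and det: "\<And>X. X \<in> S \<Longrightarrow> 4 * \<bar>det X\<bar> \<le> c\<^sup>2 * (opnorm X)\<^sup>2"
    and lower: "\<And>X. X \<in> S \<Longrightarrow> \<mu> \<le> opnorm X"
    and c: "0 < c" "c \<le> 1" and \<mu>: "0 < \<mu>"
    and "bs \<in> words S k"
  shows "(c / 2 * \<mu>) ^ k \<le> opnorm (matrix_prod bs)"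
  using assms(7)
proof (induction k arbitrary: bs)
  case 0
  then show ?case by (simp add: words_def opnorm_mat_1_eq del: matrix_vector_mul_lid)
next
  case (Suc k)
  then obtain X cs where bs: "bs = X # cs" "X \<in> S" "cs \<in> words S k"
    by (cases bs) (auto simp: words_def)
  have pos: "0 < opnorm X" if "X \<in> S" for X using lower[OF that] \<mu> by linarith
  have "(c / 2 * \<mu>) ^ Suc k = c / 2 * \<mu> * (c / 2 * \<mu>) ^ k" by simp
  also have "\<dots> \<le> c / 2 * opnorm X * opnorm (matrix_prod cs)"
    using c \<mu> lower bs Suc.IH by (intro mult_mono) auto
  also have "\<dots> \<le> opnorm (X ** matrix_prod cs)"
    using bs by (intro avalanche_step[OF mult det pos c]) (auto simp: words_def)
  finally show ?case using bs by simp
qed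

section \<open>Words of exponential growth\<close>

text \<open>
  In the application, \<open>p k\<close> is the norm of a word \<open>P\<^sub>k\<close> that grows by one letter at a time, \<open>r k\<close> is
  the norm of its product with a fixed matrix, and the recursion is \<open>opnorm_three_factors\<close>. The
  conclusion says that if the product with the long word retains only a small fraction of the norm,
  then so does the product with the shortened word.
\<close>
lemma ratio_telescope:
  fixes p r :: "nat \<Rightarrow> real"
  assumes "m \<le> n" and pos: "\<And>k. 0 < p k"
    and step: "\<And>k. m \<le> k \<Longrightarrow> k < n \<Longrightarrow> p (Suc k) * r k \<le> p k * r (Suc k) + E"
    and D: "\<And>k. m \<le> k \<Longrightarrow> k < n \<Longrightarrow> D \<le> p k * p (Suc k)" "0 < D" and "0 \<le> E"
  shows "r m / p m \<le> r n / p n + n * (E / D)"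
proof -
  have "r m / p m \<le> r n / p n + (n - m) * (E / D)"
    using \<open>m \<le> n\<close> step D(1)
  proof (induction n rule: dec_induct)
    case (step k)
    have "r k / p k \<le> r (Suc k) / p (Suc k) + E / (p k * p (Suc k))"
      using pos[of k] pos[of "Suc k"] step.prems(1)[of k] step.hyps by (simp add: field_simps)
    also have "E / (p k * p (Suc k)) \<le> E / D"
      using step.prems(2)[of k] step.hyps D(2) \<open>0 \<le> E\<close> by (intro divide_left_mono mult_pos_pos) (auto simp: pos)
    finally have "r k / p k \<le> r (Suc k) / p (Suc k) + E / D" by simp
    moreover have "r m / p m \<le> r k / p k + (k - m) * (E / D)"
      using step by simp
    ultimately show ?case using step.hyps by (simp add: Suc_diff_le algebra_simps)
  qed simp
  also have "(n - m) * (E / D) \<le> n * (E / D)"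
    using D(2) \<open>0 \<le> E\<close> by (intro mult_right_mono) auto
  finally show ?thesis by simp
qed

text \<open>
  Cut at the last time \<open>m\<close> at which the sequence is at most \<open>M\<^sup>t\<close>. As each step multiplies by at most
  \<open>M\<close>, this is not before time \<open>t\<close>, and already \<open>f m \<ge> M\<^sup>t / M\<close>.
\<close>
lemma last_time_below:
  fixes f :: "nat \<Rightarrow> real"
  assumes f0: "f 0 = 1" and step: "\<And>k. k < N \<Longrightarrow> f (Suc k) \<le> M * f k"
    and M: "1 \<le> M" and fN: "M ^ t < f N"
  shows "\<exists>m<N. t \<le> m \<and> f m \<le> M ^ t \<and> (\<forall>k. m \<le> k \<longrightarrow> k < N \<longrightarrow> M ^ (2 * t) / M \<le> f k * f (Suc k))"
proof -
  define m where "m = Max {k. k \<le> N \<and> f k \<le> M ^ t}"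
  have "m \<in> {k. k \<le> N \<and> f k \<le> M ^ t}"
    unfolding m_def by (rule Max_in) (use f0 M in \<open>auto intro!: exI[of _ 0]\<close>)
  then have m: "m \<le> N" "f m \<le> M ^ t" by auto
  have above: "M ^ t < f k" if "m < k" "k \<le> N" for k
  proof (rule ccontr)
    assume "\<not> M ^ t < f k"
    then have "k \<le> m" using that unfolding m_def by (intro Max_ge) auto
    then show False using that by simp
  qed
  have mN: "m < N" using m fN by (cases "m = N") auto
  have le: "f k \<le> M ^ k" if "k \<le> N" for k
    using that
  proof (induction k)
    case (Suc k)
    then have "f (Suc k) \<le> M * f k" using step by simp
    also have "\<dots> \<le> M * M ^ k" using Suc M by (intro mult_left_mono) auto
    finally show ?case by simp
  qed (simp add: f0)
  have "M ^ t < M ^ Suc m"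
    using above[of "Suc m"] le[of "Suc m"] mN by simp
  then have "t \<le> m" using power_less_imp_less_exp[of M t "Suc m"] M
    by (metis less_Suc_eq_le less_irrefl order_le_less power_one)
  moreover have "M ^ (2 * t) / M \<le> f k * f (Suc k)" if k: "m \<le> k" "k < N" for k
  proof -
    have gt: "M ^ t < f (Suc k)" using above[of "Suc k"] k by simp
    have "M ^ t \<le> M * f k" using gt step[of k] k by simp
    then have "M ^ t * M ^ t \<le> (M * f k) * f (Suc k)"
      using gt M by (intro mult_mono) (auto intro: order_trans[of _ "M ^ t"])
    then show ?thesis using M by (simp add: field_simps power_add[symmetric] mult_2[symmetric])
  qed
  ultimately show ?thesis using m mN by blast
qed

text \<open>
  Let \<open>P\<^sub>k\<close> be the last \<open>k\<close> letters of \<open>u\<close> and \<open>Q\<^sub>k\<close> the first \<open>k\<close> letters of \<open>v\<close>, so that both words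
  grow away from the junction. Both are cut at the last times \<open>m\<close> and \<open>l\<close> when their norms are at
  most \<open>M\<^sup>t\<close>. Since \<open>m + l \<ge> 2t\<close>, growth gives
  \<open>\<parallel>P\<^sub>m Q\<^sub>l\<parallel> \<ge> \<rho>\<^sup>2\<^sup>t \<ge> (\<rho>/M)\<^sup>2\<^sup>t \<parallel>P\<^sub>m\<parallel> \<parallel>Q\<^sub>l\<parallel>\<close>. Passing back to the full words by
  \<open>ratio_telescope\<close>, once on each side, costs at most \<open>2 N M\<^sup>2 / M\<^sup>2\<^sup>t\<close> in the ratio, because all
  norms beyond the cuts are at least about \<open>M\<^sup>t\<close>. The second condition on \<open>t\<close> says that at
  least \<open>1 / M\<^sup>2\<^sup>t\<close> is left.
\<close>
lemma almost_multiplicative: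
  fixes A :: "(real^2^2) set"
  assumes det: "\<And>a. a \<in> A \<Longrightarrow> det a = 1" and M: "1 \<le> M" "\<And>a. a \<in> A \<Longrightarrow> opnorm a \<le> M"
    and grow: "\<And>n w. w \<in> words A n \<Longrightarrow> \<rho> ^ n \<le> opnorm (matrix_prod w)" and \<rho>: "1 \<le> \<rho>"
    and t: "M ^ t < \<rho> ^ N" "1 + 2 * N * M\<^sup>2 \<le> \<rho> ^ (2 * t)"
    and u: "u \<in> words A N" and v: "v \<in> words A N"
  shows "1 / M ^ (2 * t) * opnorm (matrix_prod u) * opnorm (matrix_prod v)
           \<le> opnorm (matrix_prod u ** matrix_prod v)"
proof -
  define P where "P k = matrix_prod (drop (N - k) u)" for k
  define Q where "Q k = matrix_prod (take k v)" for k
  define p where "p k = opnorm (P k)" for k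
  define q where "q k = opnorm (Q k)" for k
  define D where "D = M ^ (2 * t) / M"
  have D: "0 < D" using M(1) by (simp add: D_def)
  have suffix: "drop (N - k) u \<in> words A (min k N)" for k
    using u by (auto simp: words_def dest: in_set_dropD)
  have "length v = N" using v by (simp add: words_def)
  then have prefix: "take k v \<in> words A (min k N)" for k
    using v by (auto simp: words_def dest: in_set_takeD)
  have dets: "det (P k) = 1" "det (Q k) = 1" for k
    unfolding P_def Q_def using det_matrix_prod_eq_1[OF suffix det] det_matrix_prod_eq_1[OF prefix det]
    by auto
  have pos: "0 < p k" "0 < q k" for k
    using opnorm_SL2_ge_1[OF dets(1), of k] opnorm_SL2_ge_1[OF dets(2), of k]
    by (simp_all add: p_def q_def)
  have P_Suc: "\<exists>a\<in>A. P (Suc k) = a ** P k" if "k < N" for k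
  proof (intro bexI)
    have "drop (N - Suc k) u = u ! (N - Suc k) # drop (N - k) u"
      using that u Cons_nth_drop_Suc[of "N - Suc k" u] by (simp add: words_def Suc_diff_Suc)
    then show "P (Suc k) = u ! (N - Suc k) ** P k" by (simp add: P_def)
    show "u ! (N - Suc k) \<in> A" using that u by (auto simp: words_def)
  qed
  have Q_Suc: "\<exists>a\<in>A. Q (Suc k) = Q k ** a" if "k < N" for k
    using that v by (intro bexI[of _ "v ! k"])
      (auto simp: Q_def words_def take_Suc_conv_app_nth matrix_prod_append)
  have ends: "P 0 = mat 1" "P N = matrix_prod u" "Q 0 = mat 1" "Q N = matrix_prod v"
    using u v by (simp_all add: P_def Q_def words_def)
  have p_Suc: "p (Suc k) \<le> M * p k" if k: "k < N" for k
  proof -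
    obtain a where a: "a \<in> A" "P (Suc k) = a ** P k" using P_Suc[OF k] by blast
    have "p (Suc k) \<le> opnorm a * p k" unfolding p_def a(2) by (rule opnorm_mult)
    also have "\<dots> \<le> M * p k" using M(2)[OF a(1)] pos(1)[of k] by (intro mult_right_mono) auto
    finally show ?thesis .
  qed
  have q_Suc: "q (Suc k) \<le> M * q k" if k: "k < N" for k
  proof -
    obtain a where a: "a \<in> A" "Q (Suc k) = Q k ** a" using Q_Suc[OF k] by blast
    have "q (Suc k) \<le> q k * opnorm a" unfolding q_def a(2) by (rule opnorm_mult)
    also have "\<dots> \<le> q k * M" using M(2)[OF a(1)] pos(2)[of k] by (intro mult_left_mono) auto
    finally show ?thesis by (simp add: mult.commute)
  qed
  have large: "M ^ t < p N" "M ^ t < q N"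
    using grow[OF u] grow[OF v] t(1) by (simp_all add: p_def q_def ends)
  have start: "p 0 = 1" "q 0 = 1"
    by (simp_all add: p_def q_def ends opnorm_mat_1_eq del: matrix_vector_mul_lid)
  obtain m where m: "m < N" "t \<le> m" "p m \<le> M ^ t"
      "\<And>k. m \<le> k \<Longrightarrow> k < N \<Longrightarrow> D \<le> p k * p (Suc k)"
    using last_time_below[of p, OF start(1) p_Suc M(1) large(1)] unfolding D_def by blast
  obtain l where l: "l < N" "t \<le> l" "q l \<le> M ^ t"
      "\<And>k. l \<le> k \<Longrightarrow> k < N \<Longrightarrow> D \<le> q k * q (Suc k)"
    using last_time_below[of q, OF start(2) q_Suc M(1) large(2)] unfolding D_def by blast
  have left: "opnorm (P m ** Q N) / p m \<le> opnorm (P N ** Q N) / p N + N * (M * q N / D)"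
  proof (rule ratio_telescope[where p = p and r = "\<lambda>k. opnorm (P k ** Q N)",
        OF less_imp_le[OF m(1)] pos(1) _ m(4) D])
    fix k assume "k < N"
    then obtain a where a: "a \<in> A" "P (Suc k) = a ** P k" using P_Suc by blast
    have "opnorm (a ** P k) * opnorm (P k ** Q N)
        \<le> opnorm (P k) * opnorm (a ** P k ** Q N) + \<bar>det (P k)\<bar> * opnorm a * opnorm (Q N)"
      by (rule opnorm_three_factors)
    also have "\<dots> \<le> opnorm (P k) * opnorm (a ** P k ** Q N) + M * opnorm (Q N)"
      using M(2)[OF a(1)] by (intro add_left_mono mult_right_mono) (auto simp: dets)
    finally show "p (Suc k) * opnorm (P k ** Q N) \<le> p k * opnorm (P (Suc k) ** Q N) + M * q N"
      by (simp add: a(2) p_def q_def)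
  qed (use M(1) pos in \<open>auto intro: less_imp_le\<close>)
  have right: "opnorm (P m ** Q l) / q l \<le> opnorm (P m ** Q N) / q N + N * (M * p m / D)"
  proof (rule ratio_telescope[where p = q and r = "\<lambda>k. opnorm (P m ** Q k)",
        OF less_imp_le[OF l(1)] pos(2) _ l(4) D])
    fix k assume "k < N"
    then obtain a where a: "a \<in> A" "Q (Suc k) = Q k ** a" using Q_Suc by blast
    have "opnorm (P m ** Q k) * opnorm (Q k ** a)
        \<le> opnorm (Q k) * opnorm (P m ** Q k ** a) + \<bar>det (Q k)\<bar> * opnorm (P m) * opnorm a"
      by (rule opnorm_three_factors)
    also have "\<dots> \<le> opnorm (Q k) * opnorm (P m ** Q k ** a) + opnorm (P m) * M"
      using M(2)[OF a(1)] by (simp add: dets mult_left_mono)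
    finally show "q (Suc k) * opnorm (P m ** Q k) \<le> q k * opnorm (P m ** Q (Suc k)) + M * p m"
      by (simp add: a(2) p_def q_def matrix_mul_assoc mult_ac)
  qed (use M(1) pos in \<open>auto intro: less_imp_le\<close>)
  have "\<rho> ^ (2 * t) \<le> \<rho> ^ (m + l)"
    using m(2) l(2) \<rho> by (intro power_increasing) auto
  also have "\<dots> \<le> opnorm (P m ** Q l)"
  proof -
    have "drop (N - m) u @ take l v \<in> words A (m + l)"
      using suffix[of m] prefix[of l] m(1) l(1) by (auto simp: words_def)
    from grow[OF this] show ?thesis by (simp add: P_def Q_def matrix_prod_append)
  qed
  finally have "\<rho> ^ (2 * t) / M ^ (2 * t) \<le> opnorm (P m ** Q l) / (p m * q l)"
    using mult_mono[OF m(3) l(3)] pos[of m] pos[of l] M(1)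
    by (intro frac_le) (auto simp: power_add[symmetric] mult_2[symmetric])
  also have "\<dots> = opnorm (P m ** Q l) / q l / p m" by simp
  also have "\<dots> \<le> (opnorm (P m ** Q N) / q N + N * (M * p m / D)) / p m"
    using right pos(1)[of m] by (intro divide_right_mono) auto
  also have "\<dots> = opnorm (P m ** Q N) / p m / q N + N * M / D"
    using pos(1)[of m] by (simp add: add_divide_distrib)
  also have "\<dots> \<le> (opnorm (P N ** Q N) / p N + N * (M * q N / D)) / q N + N * M / D"
    using left pos(2)[of N] by (intro add_right_mono divide_right_mono) auto
  also have "\<dots> = opnorm (P N ** Q N) / (p N * q N) + 2 * N * M\<^sup>2 / M ^ (2 * t)"
    using pos(2)[of N] M(1) by (simp add: add_divide_distrib D_def power2_eq_square)
  finally have "(\<rho> ^ (2 * t) - 2 * N * M\<^sup>2) / M ^ (2 * t) \<le> opnorm (P N ** Q N) / (p N * q N)"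
    by (simp add: diff_divide_distrib)
  moreover have "1 / M ^ (2 * t) \<le> (\<rho> ^ (2 * t) - 2 * N * M\<^sup>2) / M ^ (2 * t)"
    using t(2) M(1) by (intro divide_right_mono) auto
  ultimately have "1 / M ^ (2 * t) \<le> opnorm (P N ** Q N) / (p N * q N)" by linarith
  then have "1 / M ^ (2 * t) * (p N * q N) \<le> opnorm (P N ** Q N)"
    using pos[of N] by (subst (asm) pos_le_divide_eq) auto
  then show ?thesis by (simp add: p_def q_def ends mult.assoc)
qed

section \<open>Comparison of the lower spectral radius with single words\<close>

lemma lower_spectral_radius_nonneg: "A \<noteq> {} \<Longrightarrow> 0 \<le> lower_spectral_radius A"
  by (rule LIMSEQ_le_const[OF lower_spectral_radius_LIMSEQ])
    (auto intro!: cINF_greatest words_nonempty simp: real_root_ge_zero)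

lemma lower_spectral_radius_le_root:
  fixes A :: "(real^'n^'n) set"
  assumes w: "w \<in> words A n" and n: "1 \<le> n"
  shows "lower_spectral_radius A \<le> root n (opnorm (matrix_prod w))"
proof -
  have ne: "A \<noteq> {}" using assms by (auto simp: words_def)
  have "lower_spectral_radius A \<le> (INF w\<in>words A n. root n (opnorm (matrix_prod w)))"
    unfolding lower_spectral_radius_eq_INF[OF ne] using n
    by (intro cINF_lower bdd_belowI2[of _ 0] cINF_greatest words_nonempty[OF ne])
      (auto simp: real_root_ge_zero)
  also have "\<dots> \<le> root n (opnorm (matrix_prod w))"
    by (rule cINF_lower[OF bdd_below_root_opnorm w])
  finally show ?thesis .
qed

lemma lower_spectral_radius_power_le:
  fixes A :: "(real^'n^'n) set"
  assumes ne: "A \<noteq> {}" and w: "w \<in> words A n"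
  shows "lower_spectral_radius A ^ n \<le> opnorm (matrix_prod w)"
proof (cases "n = 0")
  case True
  then show ?thesis using w by (simp add: words_def opnorm_mat_1_eq del: matrix_vector_mul_lid)
next
  case False
  then have "lower_spectral_radius A ^ n \<le> root n (opnorm (matrix_prod w)) ^ n"
    using lower_spectral_radius_le_root[OF w] lower_spectral_radius_nonneg[OF ne]
    by (intro power_mono) auto
  then show ?thesis using False by simp
qed

lemma root_le_lower_spectral_radius:
  fixes A :: "(real^'n^'n) set"
  assumes ne: "A \<noteq> {}" and N: "1 \<le> N" and q: "0 \<le> q"
    and le: "\<And>k w. w \<in> words A (k * N) \<Longrightarrow> q ^ k \<le> opnorm (matrix_prod w)"
  shows "root N q \<le> lower_spectral_radius A"
proof (rule LIMSEQ_le_const)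
  have "strict_mono (\<lambda>k. k * N)" using N by (intro strict_monoI) auto
  from LIMSEQ_subseq_LIMSEQ[OF lower_spectral_radius_LIMSEQ[OF ne] this]
  show "(\<lambda>k. INF w\<in>words A (k * N). root (k * N) (opnorm (matrix_prod w)))
      \<longlonglongrightarrow> lower_spectral_radius A"
    by (simp add: o_def)
  show "\<exists>K. \<forall>k\<ge>K. root N q \<le> (INF w\<in>words A (k * N). root (k * N) (opnorm (matrix_prod w)))"
  proof (intro exI[of _ 1] allI impI cINF_greatest words_nonempty[OF ne])
    fix k w assume k: "1 \<le> k" and w: "w \<in> words A (k * N)"
    have "root N q = root (k * N) (q ^ k)"
      using k q by (simp add: mult.commute[of k] real_root_mult_exp real_root_power_cancel)
    also have "\<dots> \<le> root (k * N) (opnorm (matrix_prod w))"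
      using k N le[OF w] by (intro real_root_le_mono) auto
    finally show "root N q \<le> root (k * N) (opnorm (matrix_prod w))" .
  qed
qed

section \<open>Continuity\<close>

lemma hausdorff_near:
  assumes "A \<in> compacts S" "B \<in> compacts T" "hausdorff_dist A B < d" "a \<in> A"
  shows "\<exists>b\<in>B. opnorm (a - b) < d"
proof -
  have "(INF b\<in>B. opnorm (a - b)) < d"
    using point_dist_le_hausdorff[OF assms(1,2,4)] assms(3) by simp
  then show ?thesis
    using cINF_less_iff[of B "\<lambda>b. opnorm (a - b)" d] bdd_below_opnorm[of "\<lambda>b. a - b" B] assms(2)
    by (auto simp: compacts_def)
qed

text \<open>
  For a fixed word length \<open>n\<close>, the products over nearby sets are nearby, in both directions. The bound
  \<open>L\<close> holds for the letters of both sets, as the sets are within distance \<open>1\<close>.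
\<close>
lemma words_perturb:
  fixes A :: "(real^'n^'n) set"
  assumes A: "A \<in> compacts S" and e: "0 < e"
  shows "\<exists>d>0. \<forall>B\<in>compacts T. hausdorff_dist A B < d \<longrightarrow>
      (\<forall>w\<in>words A n. \<exists>u\<in>words B n. opnorm (matrix_prod w - matrix_prod u) \<le> e) \<and>
      (\<forall>u\<in>words B n. \<exists>w\<in>words A n. opnorm (matrix_prod u - matrix_prod w) \<le> e)"
proof -
  obtain c where c: "\<And>a. a \<in> A \<Longrightarrow> opnorm a \<le> c" using compacts_bound[OF A] by blast
  define L where "L = \<bar>c\<bar> + 1"
  define d where "d = min 1 (e / (Suc n * L ^ n))"
  have L: "1 \<le> L" by (simp add: L_def)
  then have Ln: "0 < Suc n * L ^ n" by (intro mult_pos_pos zero_less_power) auto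
  have d: "0 < d" "d \<le> 1" using e Ln by (simp_all add: d_def del: of_nat_Suc)
  have "d * (Suc n * L ^ n) \<le> e"
    using Ln by (subst pos_le_divide_eq[symmetric]) (auto simp: d_def)
  moreover have "n * d * L ^ n \<le> d * (Suc n * L ^ n)" using L d by (simp add: algebra_simps)
  ultimately have err: "n * d * L ^ n \<le> e" by simp
  have "(\<forall>w\<in>words A n. \<exists>u\<in>words B n. opnorm (matrix_prod w - matrix_prod u) \<le> e) \<and>
      (\<forall>u\<in>words B n. \<exists>w\<in>words A n. opnorm (matrix_prod u - matrix_prod w) \<le> e)"
    if B: "B \<in> compacts T" and "hausdorff_dist A B < d" for B
  proof -
    have AB: "\<exists>b\<in>B. opnorm (a - b) \<le> d" if "a \<in> A" for a
      using hausdorff_near[OF A B _ that] \<open>hausdorff_dist A B < d\<close> less_imp_le by blast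
    have BA: "\<exists>a\<in>A. opnorm (b - a) \<le> d" if "b \<in> B" for b
      using hausdorff_near[OF B A _ that] \<open>hausdorff_dist A B < d\<close> less_imp_le
      by (metis hausdorff_dist_commute)
    have LA: "opnorm a \<le> L" if "a \<in> A" for a using c[OF that] by (simp add: L_def)
    have LB: "opnorm b \<le> L" if b: "b \<in> B" for b
    proof -
      obtain a where "a \<in> A" "opnorm (b - a) \<le> d" using BA[OF b] by blast
      then show ?thesis using c[of a] opnorm_triangle[of "b - a" a] d by (simp add: L_def)
    qed
    show ?thesis
      using matrix_prod_perturb[OF AB LA LB L] matrix_prod_perturb[OF BA LB LA L] d err
      by (meson less_imp_le order_trans)
  qed
  then show ?thesis using d(1) by blast
qed

text \<open>
  The next two lemmas show that the hypotheses of the avalanche principle are open. The distance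
  \<open>1 / (6 \<Lambda>)\<close> is such that a product of two matrices moves by at most \<open>1/2\<close>; this is at most half of
  its norm, since norms in \<open>SL\<^sub>2\<close> are at least \<open>1\<close>.
\<close>
lemma near_SL2:
  fixes X Y :: "real^2^2"
  assumes det: "det Y = 1" and Y: "opnorm Y \<le> \<Lambda>" and near: "opnorm (X - Y) \<le> 1 / (6 * \<Lambda>)"
  shows "opnorm Y / 2 \<le> opnorm X" "opnorm X \<le> 2 * opnorm Y" "\<bar>det X\<bar> \<le> 2"
proof -
  have Y1: "1 \<le> opnorm Y" by (rule opnorm_SL2_ge_1[OF det])
  then have \<Lambda>: "1 \<le> \<Lambda>" using Y by linarith
  have "1 / (6 * \<Lambda>) \<le> 1 / 6" using \<Lambda> by (intro divide_left_mono) auto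
  then have n: "opnorm (X - Y) \<le> opnorm Y / 2" using near Y1 by linarith
  show "opnorm Y / 2 \<le> opnorm X"
    using n opnorm_triangle[of "Y - X" X] by (simp add: opnorm_minus_commute)
  show X: "opnorm X \<le> 2 * opnorm Y"
    using n opnorm_triangle[of "X - Y" Y] Y1 by simp
  have "\<bar>det X - det Y\<bar> \<le> opnorm (X - Y) * (opnorm X + opnorm Y)" by (rule abs_det_diff_le)
  also have "\<dots> \<le> 1 / (6 * \<Lambda>) * (3 * \<Lambda>)"
    using near X Y \<Lambda> by (intro mult_mono) auto
  also have "\<dots> = 1 / 2" using \<Lambda> by simp
  finally show "\<bar>det X\<bar> \<le> 2" using det by linarith
qed

lemma near_SL2_product:
  fixes X Y X' Y' :: "real^2^2"
  assumes det: "det Y = 1" "det Y' = 1" and Y: "opnorm Y \<le> \<Lambda>" "opnorm Y' \<le> \<Lambda>"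
    and near: "opnorm (X - Y) \<le> 1 / (6 * \<Lambda>)" "opnorm (X' - Y') \<le> 1 / (6 * \<Lambda>)"
    and c: "0 \<le> c" "c * opnorm Y * opnorm Y' \<le> opnorm (Y ** Y')"
  shows "c / 8 * opnorm X * opnorm X' \<le> opnorm (X ** X')"
proof -
  have \<Lambda>: "1 \<le> \<Lambda>" using opnorm_SL2_ge_1[OF det(1)] Y(1) by linarith
  have X: "opnorm X \<le> 2 * opnorm Y" "opnorm X' \<le> 2 * opnorm Y'"
    by (rule near_SL2(2)[OF det(1) Y(1) near(1)], rule near_SL2(2)[OF det(2) Y(2) near(2)])
  have "Y ** Y' - X ** X' = (Y - X) ** X' + Y ** (Y' - X')"
    by (vector matrix_matrix_mult_def sum_subtractf[symmetric] sum.distrib[symmetric] algebra_simps)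
  then have "opnorm (Y ** Y' - X ** X') \<le> opnorm ((Y - X) ** X') + opnorm (Y ** (Y' - X'))"
    using opnorm_triangle by metis
  also have "\<dots> \<le> opnorm (Y - X) * opnorm X' + opnorm Y * opnorm (Y' - X')"
    by (intro add_mono opnorm_mult)
  also have "\<dots> \<le> 1 / (6 * \<Lambda>) * (2 * \<Lambda>) + \<Lambda> * (1 / (6 * \<Lambda>))"
    using near X Y \<Lambda> by (intro add_mono mult_mono) (auto simp: opnorm_minus_commute)
  also have "\<dots> = 1 / 2" using \<Lambda> by simp
  finally have "opnorm (Y ** Y') \<le> opnorm (X ** X') + 1 / 2"
    using opnorm_triangle[of "Y ** Y' - X ** X'" "X ** X'"] by simp
  moreover have "1 \<le> opnorm (Y ** Y')"
    by (rule opnorm_SL2_ge_1) (simp add: det_mul det)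
  ultimately have "opnorm (Y ** Y') \<le> 2 * opnorm (X ** X')" by linarith
  moreover have "c * (opnorm X * opnorm X') \<le> c * ((2 * opnorm Y) * (2 * opnorm Y'))"
    using X c(1) by (intro mult_left_mono mult_mono) auto
  ultimately show ?thesis using c(2) by simp
qed

lemma eventually_power_le_power_sq:
  fixes x M C :: real
  assumes x: "1 < x" and M: "0 \<le> M"
  shows "eventually (\<lambda>t. C * M ^ t \<le> x ^ t\<^sup>2) sequentially"
proof -
  define K where "K = max 1 C"
  have K: "1 \<le> K" "C \<le> K" by (auto simp: K_def)
  obtain n where n: "K * M < x ^ n" using real_arch_pow[OF x] by blast
  have "eventually (\<lambda>t. K * M \<le> x ^ t) sequentially"
    using eventually_ge_at_top[of n]
  proof eventually_elim
    case (elim t)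
    have "x ^ n \<le> x ^ t" using elim x by (intro power_increasing) auto
    then show ?case using n by simp
  qed
  then show ?thesis
    using eventually_ge_at_top[of 1]
  proof eventually_elim
    case (elim t)
    have "C * M ^ t \<le> K ^ t * M ^ t"
      using K M elim self_le_power[of K t] by (intro mult_right_mono) auto
    also have "\<dots> = (K * M) ^ t" by (simp add: power_mult_distrib)
    also have "\<dots> \<le> (x ^ t) ^ t" using elim K M by (intro power_mono) auto
    finally show ?case by (simp add: power_mult[symmetric] power2_eq_square)
  qed
qed

lemma eventually_square_le_power:
  fixes x C :: real
  assumes x: "1 < x"
  shows "eventually (\<lambda>t. 1 + C * (real t)\<^sup>2 \<le> x ^ (2 * t)) sequentially"
proof -
  have "(\<lambda>t. real t * (1 / x) ^ t) \<longlonglongrightarrow> 0"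
    using x powser_times_n_limit_0[of "1 / x"] by simp
  then have "(\<lambda>t. (real t * (1 / x) ^ t)\<^sup>2) \<longlonglongrightarrow> 0\<^sup>2" by (rule tendsto_power)
  moreover have "(\<lambda>t. ((1 / x) ^ t)\<^sup>2) \<longlonglongrightarrow> 0\<^sup>2"
    using x by (intro tendsto_power LIMSEQ_power_zero) auto
  ultimately have "(\<lambda>t. ((1 / x) ^ t)\<^sup>2 + C * (real t * (1 / x) ^ t)\<^sup>2) \<longlonglongrightarrow> 0\<^sup>2 + C * 0\<^sup>2"
    by (intro tendsto_add tendsto_mult tendsto_const)
  then have "eventually (\<lambda>t. ((1 / x) ^ t)\<^sup>2 + C * (real t * (1 / x) ^ t)\<^sup>2 < 1) sequentially"
    by (rule order_tendstoD) simp
  then show ?thesis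
  proof eventually_elim
    case (elim t)
    have "((1 / x) ^ t)\<^sup>2 + C * (real t * (1 / x) ^ t)\<^sup>2 = (1 + C * (real t)\<^sup>2) / x ^ (2 * t)"
      using x by (simp add: power_mult_distrib power_divide power_mult[symmetric] mult.commute add_divide_distrib)
    then show ?case using elim x by (simp add: divide_less_eq)
  qed
qed

text \<open>
  The avalanche principle is applied to the products of \<open>N = t\<^sup>2\<close> letters of \<open>B\<close>, with the constant
  \<open>\<kappa>/8\<close> left over from \<open>\<kappa>\<close> by the perturbation. All conditions on \<open>t\<close> hold for large \<open>t\<close>, because
  \<open>\<rho>\<^sup>N\<close> is exponential in \<open>t\<^sup>2\<close> but \<open>1/\<kappa>\<close> only in \<open>t\<close>.
\<close>
lemma lower_stable_above_1:
  fixes A :: "(real^2^2) set"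
  assumes A: "A \<in> compacts SL2" and r: "1 \<le> r" "r < lower_spectral_radius A"
  shows "\<exists>d>0. \<forall>B\<in>compacts GL2. hausdorff_dist A B < d \<longrightarrow> r \<le> lower_spectral_radius B"
proof -
  define \<rho> where "\<rho> = lower_spectral_radius A"
  have \<rho>: "1 < \<rho>" "1 < \<rho> / r" using r by (auto simp: \<rho>_def)
  have ne: "A \<noteq> {}" and det: "\<And>a. a \<in> A \<Longrightarrow> det a = 1"
    using A by (auto simp: compacts_def SL2_def)
  obtain c where c: "\<And>a. a \<in> A \<Longrightarrow> opnorm a \<le> c" using compacts_bound[OF A] by blast
  define M where "M = max 1 c"
  have M: "1 \<le> M" "\<And>a. a \<in> A \<Longrightarrow> opnorm a \<le> M"
    using c by (auto simp: M_def le_max_iff_disj)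
  have grow: "\<rho> ^ n \<le> opnorm (matrix_prod w)" if "w \<in> words A n" for n w
    unfolding \<rho>_def by (rule lower_spectral_radius_power_le[OF ne that])
  \<comment> \<open>The first two conditions feed \<open>almost_multiplicative\<close>, the third makes the determinants
    negligible (fact \<open>thin\<close>), and the fourth makes the resulting rate exceed \<open>r\<close> (fact \<open>rate\<close>).\<close>
  have "eventually (\<lambda>t. 2 * M ^ t \<le> \<rho> ^ t\<^sup>2 \<and> 1 + (2 * M\<^sup>2) * (real t)\<^sup>2 \<le> \<rho> ^ (2 * t)
      \<and> 2048 * (M ^ 4) ^ t \<le> (\<rho>\<^sup>2) ^ t\<^sup>2 \<and> 32 * (M\<^sup>2) ^ t \<le> (\<rho> / r) ^ t\<^sup>2 \<and> 1 \<le> t) sequentially"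
    using \<rho> M(1)
    by (intro eventually_conj eventually_power_le_power_sq eventually_square_le_power
        eventually_ge_at_top) (auto simp: one_less_power)
  then obtain t where t: "2 * M ^ t \<le> \<rho> ^ t\<^sup>2" "1 + (2 * M\<^sup>2) * (real t)\<^sup>2 \<le> \<rho> ^ (2 * t)"
      "2048 * (M ^ 4) ^ t \<le> (\<rho>\<^sup>2) ^ t\<^sup>2" "32 * (M\<^sup>2) ^ t \<le> (\<rho> / r) ^ t\<^sup>2" "1 \<le> t"
    using eventually_happens'[OF sequentially_bot] by blast
  define N where "N = t\<^sup>2"
  define \<kappa> where "\<kappa> = 1 / M ^ (2 * t)"
  define \<Lambda> where "\<Lambda> = M ^ N"
  define \<mu> where "\<mu> = \<rho> ^ N / 2"
  have N: "1 \<le> N" using t(5) by (simp add: N_def)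
  have \<kappa>: "0 < \<kappa>" "\<kappa> \<le> 1" using M(1) by (auto simp: \<kappa>_def divide_le_eq)
  have \<Lambda>: "1 \<le> \<Lambda>" using M(1) by (simp add: \<Lambda>_def)
  have \<mu>: "0 < \<mu>" using \<rho> by (simp add: \<mu>_def)
  have Mt: "M ^ t < \<rho> ^ N" using t(1) M(1) zero_less_power[of M t] unfolding N_def by linarith
  have "1 + 2 * N * M\<^sup>2 \<le> \<rho> ^ (2 * t)" using t(2) by (simp add: N_def mult_ac)
  then have am: "\<kappa> * opnorm (matrix_prod u) * opnorm (matrix_prod v)
      \<le> opnorm (matrix_prod u ** matrix_prod v)"
    if "u \<in> words A N" "v \<in> words A N" for u v
    unfolding \<kappa>_def using \<rho>(1) by (intro almost_multiplicative[OF det M grow _ Mt _ that]) auto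
  have thin: "8 \<le> (\<kappa> / 8)\<^sup>2 * \<mu>\<^sup>2"
    using t(3) M(1)
    by (simp add: \<kappa>_def \<mu>_def N_def power_divide field_simps power_mult[symmetric])
  have rate: "r ^ N \<le> \<kappa> / 8 / 2 * \<mu>"
    using t(4) M(1) r(1)
    by (simp add: \<kappa>_def \<mu>_def N_def power_divide field_simps power_mult[symmetric])
  have "0 < 1 / (6 * \<Lambda>)" using \<Lambda> by simp
  from words_perturb[OF A this, of GL2 N] obtain d where d: "d > 0"
    "\<And>B w. B \<in> compacts GL2 \<Longrightarrow> hausdorff_dist A B < d \<Longrightarrow> w \<in> words B N \<Longrightarrow>
       \<exists>u\<in>words A N. opnorm (matrix_prod w - matrix_prod u) \<le> 1 / (6 * \<Lambda>)"
    by metis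
  have "r \<le> lower_spectral_radius B" if B: "B \<in> compacts GL2" and near: "hausdorff_dist A B < d" for B
  proof -
    define S where "S = matrix_prod ` words B N"
    have S: "\<exists>u\<in>words A N. opnorm (X - matrix_prod u) \<le> 1 / (6 * \<Lambda>)" if "X \<in> S" for X
      using d(2)[OF B near] that by (auto simp: S_def)
    have \<Lambda>u: "opnorm (matrix_prod u) \<le> \<Lambda>" and detu: "det (matrix_prod u) = 1"
      if "u \<in> words A N" for u
      using opnorm_matrix_prod_le[OF that M(2)] det_matrix_prod_eq_1[OF that det] M(1)
      by (auto simp: \<Lambda>_def)
    have mult: "\<kappa> / 8 * opnorm X * opnorm Y \<le> opnorm (X ** Y)" if XY: "X \<in> S" "Y \<in> S" for X Y
    proof -
      obtain u v where "u \<in> words A N" "opnorm (X - matrix_prod u) \<le> 1 / (6 * \<Lambda>)"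
          "v \<in> words A N" "opnorm (Y - matrix_prod v) \<le> 1 / (6 * \<Lambda>)"
        using S[OF XY(1)] S[OF XY(2)] by blast
      then show ?thesis using \<kappa>(1)
        by (intro near_SL2_product[of "matrix_prod u" "matrix_prod v" \<Lambda>] \<Lambda>u detu am) auto
    qed
    have low: "\<mu> \<le> opnorm X" and detX: "\<bar>det X\<bar> \<le> 2" if X: "X \<in> S" for X
    proof -
      obtain u where u: "u \<in> words A N" "opnorm (X - matrix_prod u) \<le> 1 / (6 * \<Lambda>)"
        using S[OF X] by blast
      note n = near_SL2[OF detu[OF u(1)] \<Lambda>u[OF u(1)] u(2)]
      show "\<mu> \<le> opnorm X" using n(1) grow[OF u(1)] by (simp add: \<mu>_def)
      show "\<bar>det X\<bar> \<le> 2" by (rule n(3))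
    qed
    have thinX: "4 * \<bar>det X\<bar> \<le> (\<kappa> / 8)\<^sup>2 * (opnorm X)\<^sup>2" if X: "X \<in> S" for X
    proof -
      have "(\<kappa> / 8)\<^sup>2 * \<mu>\<^sup>2 \<le> (\<kappa> / 8)\<^sup>2 * (opnorm X)\<^sup>2"
        using low[OF X] \<mu> by (intro mult_left_mono power_mono) auto
      then show ?thesis using thin detX[OF X] by linarith
    qed
    have "root N (\<kappa> / 8 / 2 * \<mu>) \<le> lower_spectral_radius B"
    proof (rule root_le_lower_spectral_radius[OF _ N])
      show "B \<noteq> {}" using B by (auto simp: compacts_def)
      show "0 \<le> \<kappa> / 8 / 2 * \<mu>" using \<kappa> \<mu> by simp
      fix k w assume "w \<in> words B (k * N)"
      then obtain bs where bs: "bs \<in> words S k" "matrix_prod w = matrix_prod bs"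
        using matrix_prod_blocks unfolding S_def by blast
      show "(\<kappa> / 8 / 2 * \<mu>) ^ k \<le> opnorm (matrix_prod w)"
        unfolding bs(2) using \<kappa> by (intro avalanche[OF mult thinX low _ _ \<mu> bs(1)]) auto
    qed
    moreover have "root N (r ^ N) \<le> root N (\<kappa> / 8 / 2 * \<mu>)"
      using rate N by (intro real_root_le_mono) auto
    ultimately show ?thesis using r(1) N by (simp add: real_root_power_cancel)
  qed
  then show ?thesis using d(1) by blast
qed

lemma lower_stable_below_1:
  fixes A :: "(real^2^2) set"
  assumes A: "A \<in> compacts SL2" and r: "r < 1"
  shows "\<exists>d>0. \<forall>B\<in>compacts GL2. hausdorff_dist A B < d \<longrightarrow> r \<le> lower_spectral_radius B"
proof -
  define s where "s = max 0 r"
  have s: "0 \<le> s" "s < 1" "r \<le> s" using r by (auto simp: s_def)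
  then have s2: "s\<^sup>2 < 1" by (simp add: power_less_one_iff)
  obtain c where c: "\<And>a. a \<in> A \<Longrightarrow> opnorm a \<le> c" using compacts_bound[OF A] by blast
  define L where "L = 2 * \<bar>c\<bar> + 1"
  define d where "d = min 1 ((1 - s\<^sup>2) / L)"
  have L: "1 \<le> L" by (simp add: L_def)
  have d: "0 < d" "d \<le> 1" using s2 L by (simp_all add: d_def)
  have dL: "d * L \<le> 1 - s\<^sup>2"
    using L by (subst pos_le_divide_eq[symmetric]) (auto simp: d_def)
  have "r \<le> lower_spectral_radius B" if B: "B \<in> compacts GL2" and near: "hausdorff_dist A B < d" for B
  proof -
    have det: "s\<^sup>2 \<le> \<bar>det b\<bar>" if b: "b \<in> B" for b
    proof -
      have "hausdorff_dist B A < d" using near by (simp add: hausdorff_dist_commute)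
      then obtain a where a: "a \<in> A" "opnorm (b - a) < d"
        using hausdorff_near[OF B A _ b] by blast
      have "opnorm b \<le> \<bar>c\<bar> + 1"
        using opnorm_triangle[of "b - a" a] a c[OF a(1)] d by simp
      then have "opnorm b + opnorm a \<le> L" using c[OF a(1)] by (simp add: L_def)
      then have "opnorm (b - a) * (opnorm b + opnorm a) \<le> d * L"
        using a d by (intro mult_mono add_nonneg_nonneg) auto
      moreover have "det a = 1" using A a(1) by (auto simp: compacts_def SL2_def)
      ultimately show ?thesis using abs_det_diff_le[of b a] dL by linarith
    qed
    have "root 1 s \<le> lower_spectral_radius B"
    proof (rule root_le_lower_spectral_radius)
      show "B \<noteq> {}" using B by (auto simp: compacts_def)
      fix k w assume "w \<in> words B (k * 1)"
      then have "(s\<^sup>2) ^ k \<le> \<bar>det (matrix_prod w)\<bar>"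
        by (intro abs_det_matrix_prod_ge[OF _ det]) auto
      also have "\<dots> \<le> (opnorm (matrix_prod w))\<^sup>2" by (rule abs_det_le_opnorm_sq)
      finally have "(s ^ k)\<^sup>2 \<le> (opnorm (matrix_prod w))\<^sup>2"
        by (simp add: power_mult[symmetric] mult.commute)
      then show "s ^ k \<le> opnorm (matrix_prod w)" by (rule power2_le_imp_le) simp
    qed (use s in auto)
    then show ?thesis using s by simp
  qed
  then show ?thesis using d(1) by blast
qed

lemma upper_stable:
  fixes A :: "(real^'n^'n) set"
  assumes A: "A \<in> compacts S" and r: "lower_spectral_radius A < r"
  shows "\<exists>d>0. \<forall>B\<in>compacts T. hausdorff_dist A B < d \<longrightarrow> lower_spectral_radius B \<le> r"
proof -
  have ne: "A \<noteq> {}" using A by (auto simp: compacts_def)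
  let ?b = "\<lambda>n. INF w\<in>words A n. root n (opnorm (matrix_prod w))"
  have "eventually (\<lambda>n. ?b n < r \<and> 1 \<le> n) sequentially"
    using order_tendstoD(2)[OF lower_spectral_radius_LIMSEQ[OF ne] r]
    by (intro eventually_conj eventually_ge_at_top)
  then obtain n where n: "?b n < r" "1 \<le> n"
    using eventually_happens'[OF sequentially_bot] by blast
  obtain w where w: "w \<in> words A n" "root n (opnorm (matrix_prod w)) < r"
    using n(1) cINF_less_iff[OF words_nonempty[OF ne] bdd_below_root_opnorm[of n matrix_prod]] by blast
  have r0: "0 \<le> r" using r lower_spectral_radius_nonneg[OF ne] by linarith
  have "opnorm (matrix_prod w) = root n (opnorm (matrix_prod w)) ^ n" using n(2) by simp
  also have "\<dots> < r ^ n"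
    using w(2) n(2) by (intro power_strict_mono) (auto simp: real_root_ge_zero)
  finally have e: "0 < r ^ n - opnorm (matrix_prod w)" by simp
  from words_perturb[OF A e, of T n] obtain d where d: "d > 0"
    "\<And>B. B \<in> compacts T \<Longrightarrow> hausdorff_dist A B < d \<Longrightarrow>
       \<exists>u\<in>words B n. opnorm (matrix_prod w - matrix_prod u) \<le> r ^ n - opnorm (matrix_prod w)"
    using w(1) by metis
  have "lower_spectral_radius B \<le> r" if B: "B \<in> compacts T" "hausdorff_dist A B < d" for B
  proof -
    obtain u where u: "u \<in> words B n"
        "opnorm (matrix_prod w - matrix_prod u) \<le> r ^ n - opnorm (matrix_prod w)"
      using d(2)[OF B] by blast
    have "lower_spectral_radius B \<le> root n (opnorm (matrix_prod u))"
      by (rule lower_spectral_radius_le_root[OF u(1) n(2)])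
    also have "\<dots> \<le> root n (r ^ n)"
      using u(2) n(2) opnorm_triangle[of "matrix_prod u - matrix_prod w" "matrix_prod w"]
      by (intro real_root_le_mono) (auto simp: opnorm_minus_commute)
    also have "\<dots> = r" using n(2) r0 by (simp add: real_root_power_cancel)
    finally show ?thesis .
  qed
  then show ?thesis using d(1) by blast
qed

lemma lower_spectral_radius_continuous_at_SL2:
  assumes A: "A \<in> compacts SL2" and e: "0 < e"
  shows "\<exists>d>0. \<forall>B\<in>compacts GL2. hausdorff_dist A B < d \<longrightarrow>
           dist (lower_spectral_radius B) (lower_spectral_radius A) < e"
proof -
  let ?\<rho> = "lower_spectral_radius A"
  obtain d where d: "d > 0" "\<And>B. B \<in> compacts GL2 \<Longrightarrow> hausdorff_dist A B < d \<Longrightarrow>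
      lower_spectral_radius B \<le> ?\<rho> + e / 2"
    using upper_stable[OF A, of "?\<rho> + e / 2" GL2] e by auto
  obtain d' where d': "d' > 0" "\<And>B. B \<in> compacts GL2 \<Longrightarrow> hausdorff_dist A B < d' \<Longrightarrow>
      ?\<rho> - e / 2 \<le> lower_spectral_radius B"
    using lower_stable_below_1[OF A, of "?\<rho> - e / 2"] lower_stable_above_1[OF A, of "?\<rho> - e / 2"] e
    by (cases "?\<rho> - e / 2 < 1") auto
  show ?thesis
  proof (intro exI[of _ "min d d'"] conjI ballI impI)
    fix B assume "B \<in> compacts GL2" "hausdorff_dist A B < min d d'"
    then show "dist (lower_spectral_radius B) ?\<rho> < e"
      using d(2)[of B] d'(2)[of B] e by (auto simp: dist_real_def abs_less_iff)
  qed (use d d' in auto)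
qed

lemma topcontinuous_at_hausdorffI:
  fixes f :: "(real^'n^'n) set \<Rightarrow> real"
  assumes A: "A \<in> compacts S" and range: "\<And>B. B \<in> compacts S \<Longrightarrow> 0 \<le> f B"
    and cont: "\<And>e. 0 < e \<Longrightarrow> \<exists>d>0. \<forall>B\<in>compacts S. hausdorff_dist A B < d \<longrightarrow> dist (f B) (f A) < e"
  shows "topcontinuous_at (hausdorff_topology S) (top_of_set {0..}) f A"
  unfolding topcontinuous_at_def topspace_hausdorff_topology
proof (intro conjI allI impI)
  interpret Metric_space "compacts S" "mdist (hausdorff_metric S)"
    using Metric_space_mspace_mdist[of "hausdorff_metric S"] by simp
  have top: "hausdorff_topology S = mtopology"
    by (simp add: hausdorff_topology_def mtopology_of_def)
  fix V assume V: "openin (top_of_set {0..}) V \<and> f A \<in> V"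
  then obtain e where e: "e > 0" "\<And>y. 0 \<le> y \<Longrightarrow> dist y (f A) < e \<Longrightarrow> y \<in> V"
    by (auto simp: openin_euclidean_subtopology_iff)
  obtain d where d: "d > 0" "\<And>B. B \<in> compacts S \<Longrightarrow> hausdorff_dist A B < d \<Longrightarrow> dist (f B) (f A) < e"
    using cont[OF e(1)] by blast
  show "\<exists>U. openin (hausdorff_topology S) U \<and> A \<in> U \<and> (\<forall>y\<in>U. f y \<in> V)"
    unfolding top
  proof (intro exI[of _ "mball A d"] conjI ballI)
    show "A \<in> mball A d" using A d(1) by simp
    fix B assume "B \<in> mball A d"
    then have "B \<in> compacts S" "hausdorff_dist A B < d"
      using A by (auto simp: mdist_hausdorff_metric)
    then show "f B \<in> V" using d(2) e(2) range by blast
  qed simp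
qed (use A range in auto)

theorem corollary1p3:
  shows "(\<forall>A \<in> compacts SL2.
            topcontinuous_at (hausdorff_topology GL2) (top_of_set {0..}) lower_spectral_radius A) \<and>
         continuous_map (hausdorff_topology SL2) (top_of_set {0..}) lower_spectral_radius"
proof -
  have mono: "compacts SL2 \<subseteq> compacts GL2" using SL2_subset_GL2 by (auto simp: compacts_def)
  have nonneg: "0 \<le> lower_spectral_radius B" if "B \<in> compacts S" for B :: "(real^2^2) set" and S
    using that by (intro lower_spectral_radius_nonneg) (auto simp: compacts_def)
  have "topcontinuous_at (hausdorff_topology S) (top_of_set {0..}) lower_spectral_radius A"
    if A: "A \<in> compacts SL2" and S: "S = GL2 \<or> S = SL2" for A S
  proof (rule topcontinuous_at_hausdorffI)
    have sub: "compacts S \<subseteq> compacts GL2" using S mono by blast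
    show "A \<in> compacts S" using A S mono by blast
    show "0 \<le> lower_spectral_radius B" if "B \<in> compacts S" for B using nonneg that .
    show "\<exists>d>0. \<forall>B\<in>compacts S. hausdorff_dist A B < d \<longrightarrow>
        dist (lower_spectral_radius B) (lower_spectral_radius A) < e" if "0 < e" for e
      using lower_spectral_radius_continuous_at_SL2[OF A that] sub by (meson subsetD)
  qed
  then show ?thesis by (simp add: continuous_map_eq_topcontinuous_at)
qed

end
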